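(* Let $D$ be a nonnegative integer valued random variable and, for $p\in(0,1)$, let $S_D$ denote the $p$-thinning of $D$. Let $k\ge1$ be an integer and suppose $\mathbb{E}D^{k-1}<\infty$. Then $$\lim_{p\to0}\frac{\mathbb{P}(S_D\ge k)}{\mathbb{P}(S_D=k-1)}=0,$$ provided that the denominator is strictly positive. As a consequence, if $m$ is a positive integer, $\mathbb{E}D^m<\infty$ and $\mathbb{P}(D\ge m)>0$, then $$\lim_{p\to0}\mathbb{P}(S_D=m\mid S_D\ge m)=1.$$
   Context: For a nonnegative integer valued random variable $D$ and $p\in(0,1)$, the $p$-thinning of $D$ is $S_D=\sum_{i=1}^{D}X_i$, where $X_1,X_2,\dots$ are i.i.d. Bernoulli($p$) random variables independent of $D$ (the dependence of $S_D$ on $p$ is suppressed in the notation). Limits are as $p\downarrow 0$ through $p\in(0,1)$. The convention $D^0=1$ is used. *)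

theory Defs
  imports "HOL-Probability.Probability"
begin

text \<open>
  \<open>X 1, X 2, \<dots>\<close> are i.i.d. Bernoulli(\<open>p\<close>) with values in \<open>{0, 1}\<close>, and the sequence is independent
  of \<open>D\<close>. The entry \<open>X 0\<close> is not used; putting \<open>D\<close> in its place expresses that the family
  \<open>D, X 1, X 2, \<dots>\<close> is mutually independent, which says both that the \<open>X i\<close> are independent and that
  they are jointly independent of \<open>D\<close>.
\<close>
definition iid_bernoulli_indep ::
    "'a measure \<Rightarrow> real \<Rightarrow> ('a \<Rightarrow> nat) \<Rightarrow> (nat \<Rightarrow> 'a \<Rightarrow> nat) \<Rightarrow> bool" where
  "iid_bernoulli_indep M p D X \<longleftrightarrow>
     prob_space.indep_vars M (\<lambda>_. count_space UNIV) (X(0 := D)) UNIV \<and>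
     (\<forall>i\<ge>1. distr M (count_space UNIV) (X i) = measure_pmf (map_pmf of_bool (bernoulli_pmf p)))"

definition thinning :: "('a \<Rightarrow> nat) \<Rightarrow> (nat \<Rightarrow> 'a \<Rightarrow> nat) \<Rightarrow> 'a \<Rightarrow> nat" where
  "thinning D X \<omega> = (\<Sum>i = 1..D \<omega>. X i \<omega>)"

end

theory Submission imports Defs begin

text \<open>
  Conditionally on \<open>D = d\<close>, the thinning is a sum of \<open>d\<close> independent Bernoulli(\<open>p\<close>) variables, so
  its law is the mixture of the binomial laws \<open>Bin(d, p)\<close> under the law of \<open>D\<close>
  (\<open>distr_thinning\<close>). The statement is therefore one about mixtures of binomial distributions,
  and the random variables disappear.

  Write \<open>j = k - 1\<close> and divide both probabilities in the quotient by \<open>p ^ j\<close>. For fixed \<open>d\<close> the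
  point probability \<open>P(Bin(d, p) = j) / p ^ j\<close> tends to \<open>d choose j\<close>, while
  \<open>P(Bin(d, p) \<ge> j + 1) / p ^ j\<close> is at most \<open>(d choose (j + 1)) * p\<close> and tends to \<open>0\<close>. The
  coefficient \<open>d choose (j + 1)\<close> must not be integrated over \<open>d\<close>, since the moment of order
  \<open>j + 1\<close> may be infinite. But an event inside \<open>{j..}\<close> has
  probability at most \<open>(d choose j) * p ^ j \<le> d ^ j * p ^ j\<close> under \<open>Bin(d, p)\<close>
  (\<open>binomial_pmf_tail_le\<close>), so both rescaled quantities are dominated by \<open>d ^ j\<close>, which is
  integrable by hypothesis. Dominated convergence (\<open>thin_pmf_rescaled_tendsto\<close>) gives the limits
  \<open>0\<close> for the numerator and \<open>E (D choose j)\<close> for the denominator. The latter is positive exactly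
  when \<open>P(D \<ge> j) > 0\<close>, which is also equivalent to the positivity of the denominator
  for a single \<open>p\<close> in \<open>(0, 1)\<close> (\<open>thin_pmf_pos_iff\<close>).

  The conditional probability in the second part is \<open>1 / (1 + r)\<close>, where \<open>r\<close> is the quotient
  of the first part for \<open>k = m + 1\<close>.
\<close>

section \<open>The law of a thinned variable\<close>

definition thin_pmf :: "nat pmf \<Rightarrow> real \<Rightarrow> nat pmf" where
  "thin_pmf q p = bind_pmf q (\<lambda>d. binomial_pmf d p)"

text \<open>
  Since \<open>nat\<close> is countable, the atoms of mass zero form a null set, which is all that separates
  an arbitrary law on \<open>nat\<close> from a probability mass function.
\<close>
lemma (in prob_space) ex_pmf_eq_distr:
  fixes U :: "'a \<Rightarrow> nat"
  assumes [measurable]: "U \<in> measurable M (count_space UNIV)"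
  shows "\<exists>q. distr M (count_space UNIV) U = measure_pmf q"
proof -
  let ?N = "distr M (count_space UNIV) U"
  interpret N: prob_space ?N by (rule prob_space_distr) simp
  have "AE x in ?N. measure ?N {x} \<noteq> 0"
  proof -
    have "(\<Union>x\<in>{x. measure ?N {x} = 0}. {x}) \<in> null_sets ?N"
      by (rule null_sets_UN') (auto simp: null_sets_def N.emeasure_eq_measure)
    then show ?thesis by (rule AE_I') auto
  qed
  then have "measure_pmf (Abs_pmf ?N) = ?N"
    by (intro Abs_pmf_inverse) (simp add: N.prob_space_axioms)
  then show ?thesis by metis
qed

text \<open>
  The law of total probability: on the event \<open>U = n\<close> the random variable \<open>V (U \<omega>) \<omega>\<close> is \<open>V n\<close>,
  which independence leaves with its own law \<open>K n\<close>. The lemma serves twice below: with \<open>U\<close> the last summand it yields the convolution step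
  for binomial laws, and with \<open>U = D\<close> the law of the thinning.
\<close>
lemma (in prob_space) distr_random_index:
  fixes U :: "'a \<Rightarrow> nat" and V :: "nat \<Rightarrow> 'a \<Rightarrow> nat"
  assumes U: "distr M (count_space UNIV) U = measure_pmf q"
    and V: "\<And>n. distr M (count_space UNIV) (V n) = measure_pmf (K n)"
    and indep: "\<And>n. indep_var (count_space UNIV) U (count_space UNIV) (V n)"
  shows "distr M (count_space UNIV) (\<lambda>\<omega>. V (U \<omega>) \<omega>) = measure_pmf (bind_pmf q K)"
proof (rule measure_eqI)
  have mU[measurable]: "U \<in> measurable M (count_space UNIV)"
    using indep_var_rv1[OF indep] .
  have mV[measurable]: "V n \<in> measurable M (count_space UNIV)" for n
    using indep_var_rv2[OF indep] .
  have mVU[measurable]: "(\<lambda>\<omega>. V (U \<omega>) \<omega>) \<in> measurable M (count_space UNIV)"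
    by (rule measurable_compose_countable[OF mV mU])
  fix A :: "nat set"
  let ?E = "\<lambda>n. {\<omega> \<in> space M. U \<omega> = n \<and> V n \<omega> \<in> A}"
  have E: "emeasure M (?E n) = ennreal (pmf q n) * emeasure (K n) A" for n
  proof -
    have "prob ((\<lambda>x. (U x, V n x)) -` ({n} \<times> A) \<inter> space M) =
        prob (U -` {n} \<inter> space M) * prob (V n -` A \<inter> space M)"
      by (rule indep_varD[OF indep]) auto
    also have "prob (U -` {n} \<inter> space M) = measure (distr M (count_space UNIV) U) {n}"
      by (subst measure_distr) auto
    also have "\<dots> = pmf q n" by (simp add: U measure_pmf_single)
    also have "prob (V n -` A \<inter> space M) = measure (distr M (count_space UNIV) (V n)) A"
      by (subst measure_distr) auto
    also have "\<dots> = measure (K n) A" by (simp only: V)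
    finally have "prob (?E n) = pmf q n * measure (K n) A"
      by (simp add: vimage_def Int_def conj_commute)
    then show ?thesis
      by (simp add: emeasure_eq_measure measure_pmf.emeasure_eq_measure ennreal_mult)
  qed
  have "emeasure (distr M (count_space UNIV) (\<lambda>\<omega>. V (U \<omega>) \<omega>)) A = emeasure M (\<Union>n. ?E n)"
    by (subst emeasure_distr) (auto intro!: arg_cong[where f="emeasure M"])
  also have "\<dots> = (\<Sum>n. emeasure M (?E n))"
    by (rule suminf_emeasure[symmetric]) (auto simp: disjoint_family_on_def)
  also have "\<dots> = (\<integral>\<^sup>+ n. ennreal (pmf q n) * emeasure (K n) A \<partial>count_space UNIV)"
    by (simp add: E nn_integral_count_space_nat)
  also have "\<dots> = (\<integral>\<^sup>+ n. emeasure (K n) A \<partial>measure_pmf q)"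
    by (simp add: nn_integral_measure_pmf)
  also have "\<dots> = emeasure (bind_pmf q K) A" by simp
  finally show "emeasure (distr M (count_space UNIV) (\<lambda>\<omega>. V (U \<omega>) \<omega>)) A = emeasure (bind_pmf q K) A" .
qed simp

lemma (in prob_space) indep_var_sum_disjoint:
  fixes Z :: "'i \<Rightarrow> 'a \<Rightarrow> nat"
  assumes ind: "indep_vars (\<lambda>_. count_space UNIV) Z UNIV" and J: "finite J" "i \<notin> J"
  shows "indep_var (count_space UNIV) (Z i) (count_space UNIV) (\<lambda>\<omega>. \<Sum>j\<in>J. Z j \<omega>)"
proof -
  have "indep_var (PiM {i} (\<lambda>_. count_space UNIV)) (\<lambda>\<omega>. restrict (\<lambda>i. Z i \<omega>) {i})
                  (PiM J (\<lambda>_. count_space UNIV)) (\<lambda>\<omega>. restrict (\<lambda>i. Z i \<omega>) J)"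
    using J by (intro indep_var_restrict[OF ind]) auto
  then have "indep_var (count_space UNIV) ((\<lambda>f. f i) \<circ> (\<lambda>\<omega>. restrict (\<lambda>i. Z i \<omega>) {i}))
                  (count_space UNIV) ((\<lambda>f. \<Sum>j\<in>J. f j) \<circ> (\<lambda>\<omega>. restrict (\<lambda>i. Z i \<omega>) J))"
  proof (rule indep_var_compose)
    show "(\<lambda>f. f i) \<in> PiM {i} (\<lambda>_. count_space (UNIV :: nat set)) \<rightarrow>\<^sub>M count_space UNIV"
      by (rule measurable_component_singleton) simp
    show "(\<lambda>f. \<Sum>j\<in>J. f j) \<in> PiM J (\<lambda>_. count_space (UNIV :: nat set)) \<rightarrow>\<^sub>M count_space UNIV"
    proof -
      have "(\<lambda>f. \<Sum>j\<in>I. f j) \<in> PiM J (\<lambda>_. count_space (UNIV :: nat set)) \<rightarrow>\<^sub>M count_space UNIV"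
        if "finite I" "I \<subseteq> J" for I
        using that
      proof (induction I rule: finite_induct)
        case (insert x F)
        have F: "(\<lambda>f. \<Sum>j\<in>F. f j) \<in> PiM J (\<lambda>_. count_space (UNIV :: nat set)) \<rightarrow>\<^sub>M count_space UNIV"
          using insert by simp
        have x: "(\<lambda>f. f x) \<in> PiM J (\<lambda>_. count_space (UNIV :: nat set)) \<rightarrow>\<^sub>M count_space UNIV"
          using insert by (intro measurable_component_singleton) simp
        have "(\<lambda>f. (\<lambda>n f. n + (\<Sum>j\<in>F. f j)) (f x) f) \<in> PiM J (\<lambda>_. count_space (UNIV :: nat set)) \<rightarrow>\<^sub>M count_space UNIV"
          by (rule measurable_compose_countable[OF _ x], rule measurable_compose[OF F]) simp
        then show ?case using insert by simp
      qed simp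
      then show ?thesis using J by simp
    qed
  qed
  then show ?thesis by (simp add: comp_def)
qed

text \<open>
  Induction on \<open>n\<close>: conditioning on the last summand reproduces the recursion
  \<open>binomial_pmf_Suc\<close> of the binomial distribution. The sum starts at index \<open>1\<close> because \<open>Z 0\<close>
  is the place of the thinned variable itself.
\<close>
lemma (in prob_space) distr_sum_bernoulli:
  assumes p: "p \<in> {0..1}"
    and ind: "indep_vars (\<lambda>_. count_space UNIV) (Z :: nat \<Rightarrow> 'a \<Rightarrow> nat) UNIV"
    and Z: "\<And>i. i \<ge> 1 \<Longrightarrow> distr M (count_space UNIV) (Z i) = measure_pmf (map_pmf of_bool (bernoulli_pmf p))"
  shows "distr M (count_space UNIV) (\<lambda>\<omega>. \<Sum>i = 1..n. Z i \<omega>) = measure_pmf (binomial_pmf n p)"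
proof (induction n)
  case 0
  have "distr M (count_space UNIV) (\<lambda>_. 0::nat) = measure_pmf (return_pmf 0)"
    by (rule measure_eqI) (auto simp: emeasure_distr emeasure_space_1 indicator_def)
  then show ?case using p by (simp add: binomial_pmf_0)
next
  case (Suc n)
  let ?S = "\<lambda>\<omega>. \<Sum>i = 1..n. Z i \<omega>"
  have indS: "indep_var (count_space UNIV) (Z (Suc n)) (count_space UNIV) ?S"
    by (rule indep_var_sum_disjoint[OF ind]) auto
  have mS: "?S \<in> measurable M (count_space UNIV)"
    using indep_var_rv2[OF indS] .
  have "distr M (count_space UNIV) (\<lambda>\<omega>. (\<lambda>b \<omega>. b + ?S \<omega>) (Z (Suc n) \<omega>) \<omega>) =
     measure_pmf (bind_pmf (map_pmf of_bool (bernoulli_pmf p)) (\<lambda>b. map_pmf (\<lambda>s. b + s) (binomial_pmf n p)))"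
  proof (rule distr_random_index[where V = "\<lambda>b \<omega>. b + ?S \<omega>"])
    show "distr M (count_space UNIV) (Z (Suc n)) = measure_pmf (map_pmf of_bool (bernoulli_pmf p))"
      by (rule Z) simp
    show "distr M (count_space UNIV) (\<lambda>\<omega>. b + ?S \<omega>) = measure_pmf (map_pmf (\<lambda>s. b + s) (binomial_pmf n p))" for b
    proof -
      have "distr M (count_space UNIV) (\<lambda>\<omega>. b + ?S \<omega>) =
          distr (distr M (count_space UNIV) ?S) (count_space UNIV) (\<lambda>s. b + s)"
        by (subst distr_distr[OF _ mS]) (auto simp: comp_def)
      then show ?thesis unfolding Suc.IH map_pmf_rep_eq .
    qed
    show "indep_var (count_space UNIV) (Z (Suc n)) (count_space UNIV) (\<lambda>\<omega>. b + ?S \<omega>)" for b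
      using indep_var_compose[OF indS, of "\<lambda>x. x" "count_space UNIV" "\<lambda>s. b + s" "count_space UNIV"]
      by (simp add: comp_def)
  qed
  moreover have "bind_pmf (map_pmf of_bool (bernoulli_pmf p)) (\<lambda>b. map_pmf (\<lambda>s. b + s) (binomial_pmf n p))
      = binomial_pmf (Suc n) p"
    using p unfolding binomial_pmf_Suc[OF p] bind_map_pmf
    by (auto simp: map_pmf_def intro!: bind_pmf_cong)
  ultimately show ?case by (simp add: add.commute)
qed

lemma (in prob_space) distr_thinning:
  assumes p: "0 < p" "p < 1" and X: "iid_bernoulli_indep M p D X"
    and D: "distr M (count_space UNIV) D = measure_pmf q"
  shows "distr M (count_space UNIV) (thinning D X) = measure_pmf (thin_pmf q p)"
proof -
  let ?Z = "X(0 := D)"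
  have ind: "indep_vars (\<lambda>_. count_space UNIV) ?Z UNIV"
    and Z: "\<And>i. i \<ge> 1 \<Longrightarrow> distr M (count_space UNIV) (?Z i) = measure_pmf (map_pmf of_bool (bernoulli_pmf p))"
    using X by (auto simp: iid_bernoulli_indep_def)
  have eq: "(\<lambda>\<omega>. \<Sum>i = 1..d. ?Z i \<omega>) = (\<lambda>\<omega>. \<Sum>i = 1..d. X i \<omega>)" for d
    by (intro ext sum.cong) auto
  have "distr M (count_space UNIV) (\<lambda>\<omega>. (\<lambda>d \<omega>. \<Sum>i = 1..d. X i \<omega>) (D \<omega>) \<omega>)
      = measure_pmf (bind_pmf q (\<lambda>d. binomial_pmf d p))"
  proof (rule distr_random_index[OF D])
    show "distr M (count_space UNIV) (\<lambda>\<omega>. \<Sum>i = 1..d. X i \<omega>) = measure_pmf (binomial_pmf d p)" for d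
      using distr_sum_bernoulli[OF _ ind Z, of d] p unfolding eq by simp
    show "indep_var (count_space UNIV) D (count_space UNIV) (\<lambda>\<omega>. \<Sum>i = 1..d. X i \<omega>)" for d
      using indep_var_sum_disjoint[OF ind, of "{1..d}" 0] unfolding eq by simp
  qed
  then show ?thesis by (simp add: thinning_def[abs_def] thin_pmf_def)
qed

section \<open>Binomial laws for small success probability\<close>

lemma measure_bind_pmf:
  fixes K :: "'a \<Rightarrow> 'b pmf"
  shows "measure_pmf.prob (bind_pmf q K) A = measure_pmf.expectation q (\<lambda>x. measure_pmf.prob (K x) A)"
  unfolding measure_pmf_bind
  by (rule measure_pmf.measure_bind[where N="count_space UNIV"])
     (auto simp: measurable_def space_subprob_algebra intro: measure_pmf.subprob_space_axioms)

text \<open>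
  This is the union bound over the \<open>j\<close>-element sets of trials that could all succeed. Conditioning
  on one trial turns it into Pascal's rule, with the factor \<open>1 - p\<close> of a failure estimated by \<open>1\<close>.
\<close>
lemma binomial_pmf_tail_le:
  assumes p: "p \<in> {0..1}"
  shows "measure_pmf.prob (binomial_pmf d p) {j..} \<le> real (d choose j) * p ^ j"
proof (induction d arbitrary: j)
  case 0
  then show ?case using p by (simp add: binomial_pmf_0 indicator_def) 
next
  case (Suc d)
  show ?case
  proof (cases j)
    case 0
    then show ?thesis by simp
  next
    case (Suc i)
    have "measure_pmf.prob (binomial_pmf (Suc d) p) {Suc i..} =
        measure_pmf.expectation (bernoulli_pmf p)
          (\<lambda>b. measure_pmf.prob (map_pmf (\<lambda>k. (if b then 1 else 0) + k) (binomial_pmf d p)) {Suc i..})"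
      using p by (simp only: binomial_pmf_Suc map_pmf_def measure_bind_pmf)
    also have "\<dots> = p * measure_pmf.prob (binomial_pmf d p) {i..}
        + (1 - p) * measure_pmf.prob (binomial_pmf d p) {Suc i..}"
      using p by (simp add: vimage_def atLeast_def)
    also have "\<dots> \<le> p * (real (d choose i) * p ^ i) + 1 * (real (d choose Suc i) * p ^ Suc i)"
      using p by (intro add_mono mult_mono Suc.IH) auto
    also have "\<dots> = real (Suc d choose Suc i) * p ^ Suc i"
      by (simp add: algebra_simps)
    finally show ?thesis using Suc by simp
  qed
qed

lemma binomial_le_power: "n choose k \<le> n ^ k"
  by (cases "k \<le> n") (simp_all add: binomial_le_pow binomial_eq_0)

lemma eventually_in_unit_interval: "\<forall>\<^sub>F p in at_right (0::real). 0 < p \<and> p < 1"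
  using eventually_at_right_real[of 0 "1::real"] by simp

lemma binomial_pmf_rescaled_tendsto:
  "((\<lambda>p. measure_pmf.prob (binomial_pmf d p) {j} / p ^ j) \<longlongrightarrow> real (d choose j)) (at_right 0)"
proof -
  have "((\<lambda>p. real (d choose j) * (1 - p) ^ (d - j)) \<longlongrightarrow> real (d choose j) * (1 - 0) ^ (d - j)) (at_right (0::real))"
    by (intro tendsto_intros)
  moreover from eventually_in_unit_interval have "\<forall>\<^sub>F p in at_right 0. real (d choose j) * (1 - p) ^ (d - j)
      = measure_pmf.prob (binomial_pmf d p) {j} / p ^ j"
    by eventually_elim (simp add: measure_pmf_single)
  ultimately show ?thesis by (simp add: tendsto_cong)
qed

lemma binomial_pmf_tail_rescaled_tendsto:
  "((\<lambda>p. measure_pmf.prob (binomial_pmf d p) {Suc j..} / p ^ j) \<longlongrightarrow> 0) (at_right 0)"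
proof (rule tendsto_sandwich)
  show "\<forall>\<^sub>F p in at_right 0. 0 \<le> measure_pmf.prob (binomial_pmf d p) {Suc j..} / p ^ j"
    using eventually_in_unit_interval by eventually_elim simp
  show "\<forall>\<^sub>F p in at_right 0. measure_pmf.prob (binomial_pmf d p) {Suc j..} / p ^ j \<le> real (d choose Suc j) * p"
    using eventually_in_unit_interval
  proof eventually_elim
    case (elim p)
    then show ?case
      using binomial_pmf_tail_le[of p d "Suc j"] by (simp add: divide_le_eq mult.assoc)
  qed
  show "((\<lambda>p. real (d choose Suc j) * p) \<longlongrightarrow> 0) (at_right 0)"
    by (rule tendsto_mult_right_zero) (rule tendsto_ident_at)
qed simp

section \<open>Passing to the mixture\<close>

text \<open>
  Dominated convergence. As \<open>A\<close> lies in \<open>{j..}\<close>, the tail bound dominates the rescaled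
  probabilities by \<open>d ^ j\<close> uniformly in \<open>p\<close>, so a limit for each fixed \<open>d\<close> may be integrated.
\<close>
lemma thin_pmf_rescaled_tendsto:
  assumes int: "integrable (measure_pmf q) (\<lambda>d. real d ^ j)"
    and A: "A \<subseteq> {j..}"
    and lim: "\<And>d. ((\<lambda>p. measure_pmf.prob (binomial_pmf d p) A / p ^ j) \<longlongrightarrow> c d) (at_right 0)"
  shows "((\<lambda>p. measure_pmf.prob (thin_pmf q p) A / p ^ j)
           \<longlongrightarrow> measure_pmf.expectation q c) (at_right 0)"
proof (rule tendsto_at_right_sequentially[where b = 1])
  fix s :: "nat \<Rightarrow> real"
  assume s: "\<And>n. 0 < s n" "\<And>n. s n < 1" "s \<longlonglongrightarrow> 0"
  have "filterlim s (at_right 0) sequentially"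
    using s by (auto simp: filterlim_at intro!: always_eventually less_imp_neq[THEN not_sym])
  then have lim': "(\<lambda>n. measure_pmf.prob (binomial_pmf d (s n)) A / s n ^ j) \<longlonglongrightarrow> c d" for d
    by (rule filterlim_compose[OF lim])
  have bound: "measure_pmf.prob (binomial_pmf d (s n)) A / s n ^ j \<le> real d ^ j" for d n
  proof -
    have "measure_pmf.prob (binomial_pmf d (s n)) A \<le> measure_pmf.prob (binomial_pmf d (s n)) {j..}"
      using A by (intro measure_pmf.finite_measure_mono) auto
    also have "\<dots> \<le> real (d choose j) * s n ^ j"
      using s(1,2)[of n] by (intro binomial_pmf_tail_le) auto
    also have "\<dots> \<le> real d ^ j * s n ^ j"
      using s(1)[of n] binomial_le_power[of d j]
      by (intro mult_right_mono) (simp_all flip: of_nat_power)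
    finally show ?thesis using s(1)[of n] by (simp add: divide_le_eq)
  qed
  have "(\<lambda>n. measure_pmf.expectation q (\<lambda>d. measure_pmf.prob (binomial_pmf d (s n)) A / s n ^ j))
      \<longlonglongrightarrow> measure_pmf.expectation q c"
  proof (rule integral_dominated_convergence[OF _ _ int])
    show "AE d in measure_pmf q. (\<lambda>n. measure_pmf.prob (binomial_pmf d (s n)) A / s n ^ j) \<longlonglongrightarrow> c d"
      using lim' by simp
    show "AE d in measure_pmf q. norm (measure_pmf.prob (binomial_pmf d (s n)) A / s n ^ j) \<le> real d ^ j" for n
      using bound[of _ n] s(1)[of n] by simp
  qed auto
  then show "(\<lambda>n. measure_pmf.prob (thin_pmf q (s n)) A / s n ^ j) \<longlonglongrightarrow> measure_pmf.expectation q c"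
    by (simp add: thin_pmf_def measure_bind_pmf)
qed simp

text \<open>
  After rescaling by \<open>p ^ j\<close> the numerator tends to \<open>0\<close> and the denominator to the binomial moment
  \<open>?m\<close>, which is positive because \<open>d choose j \<ge> 1\<close> for \<open>d \<ge> j\<close>.
\<close>
lemma thin_pmf_ratio_tendsto:
  assumes int: "integrable (measure_pmf q) (\<lambda>d. real d ^ j)"
    and pos: "measure_pmf.prob q {j..} > 0"
  shows "((\<lambda>p. measure_pmf.prob (thin_pmf q p) {Suc j..} / measure_pmf.prob (thin_pmf q p) {j})
           \<longlongrightarrow> 0) (at_right 0)"
proof -
  let ?m = "measure_pmf.expectation q (\<lambda>d. real (d choose j))"
  have num: "((\<lambda>p. measure_pmf.prob (thin_pmf q p) {Suc j..} / p ^ j) \<longlongrightarrow> 0) (at_right 0)"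
    using thin_pmf_rescaled_tendsto[OF int _ binomial_pmf_tail_rescaled_tendsto] by simp
  have den: "((\<lambda>p. measure_pmf.prob (thin_pmf q p) {j} / p ^ j) \<longlongrightarrow> ?m) (at_right 0)"
    by (rule thin_pmf_rescaled_tendsto[OF int _ binomial_pmf_rescaled_tendsto]) simp
  have "?m \<noteq> 0"
  proof -
    have int_choose: "integrable (measure_pmf q) (\<lambda>d. real (d choose j))"
      using binomial_le_power
      by (intro Bochner_Integration.integrable_bound[OF int]) (auto simp flip: of_nat_power)
    have "measure_pmf.prob q {j..} \<le> ?m"
    proof -
      have "measure_pmf.prob q {j..} = measure_pmf.expectation q (indicator {j..})"
        by simp
      also have "\<dots> \<le> ?m"
        by (rule integral_mono[OF _ int_choose])
           (auto simp: indicator_def Suc_le_eq intro!: measure_pmf.integrable_const_bound[where B=1])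
      finally show ?thesis .
    qed
    then show ?thesis using pos by simp
  qed
  with tendsto_divide[OF num den]
  have "((\<lambda>p. (measure_pmf.prob (thin_pmf q p) {Suc j..} / p ^ j)
      / (measure_pmf.prob (thin_pmf q p) {j} / p ^ j)) \<longlongrightarrow> 0) (at_right 0)"
    by (simp del: divide_divide_eq_left divide_divide_eq_right)
  moreover from eventually_in_unit_interval have "\<forall>\<^sub>F p in at_right 0. (measure_pmf.prob (thin_pmf q p) {Suc j..} / p ^ j)
      / (measure_pmf.prob (thin_pmf q p) {j} / p ^ j)
      = measure_pmf.prob (thin_pmf q p) {Suc j..} / measure_pmf.prob (thin_pmf q p) {j}"
    by eventually_elim simp
  ultimately show ?thesis by (rule Lim_transform_eventually)
qed

text \<open>
  A binomial law with \<open>0 < p < 1\<close> charges every point of \<open>{..d}\<close>. This translates between the two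
  forms in which positivity is assumed: of the denominator in the first limit, of \<open>P(D \<ge> m)\<close> in
  the second.
\<close>
lemma thin_pmf_pos_iff:
  assumes "0 < p" "p < 1"
  shows "measure_pmf.prob (thin_pmf q p) {j} > 0 \<longleftrightarrow> measure_pmf.prob q {j..} > 0"
proof -
  have "measure_pmf.prob (thin_pmf q p) {j} > 0 \<longleftrightarrow> j \<in> set_pmf (thin_pmf q p)"
    by (simp add: measure_pmf_single pmf_positive_iff)
  also have "\<dots> \<longleftrightarrow> set_pmf q \<inter> {j..} \<noteq> {}"
    using assms by (auto simp: thin_pmf_def)
  also have "\<dots> \<longleftrightarrow> measure_pmf.prob q {j..} > 0"
    by (auto simp: zero_less_measure_iff measure_pmf_zero_iff)
  finally show ?thesis .
qed

section \<open>Thinning at vanishing retention probability\<close>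

theorem theorem4:
  fixes M :: "'a measure"
    and D :: "'a \<Rightarrow> nat"
    and X :: "real \<Rightarrow> nat \<Rightarrow> 'a \<Rightarrow> nat"
  assumes "prob_space M"
    and "D \<in> measurable M (count_space UNIV)"
    and "\<And>p. 0 < p \<Longrightarrow> p < 1 \<Longrightarrow> iid_bernoulli_indep M p D (X p)"
  shows "(\<forall>k::nat. k \<ge> 1 \<longrightarrow>
            integrable M (\<lambda>\<omega>. real (D \<omega>) ^ (k - 1)) \<longrightarrow>
            (\<forall>\<^sub>F p in at_right 0. \<P>(\<omega> in M. thinning D (X p) \<omega> = k - 1) > 0) \<longrightarrow>
            ((\<lambda>p. \<P>(\<omega> in M. thinning D (X p) \<omega> \<ge> k) / \<P>(\<omega> in M. thinning D (X p) \<omega> = k - 1))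
               \<longlongrightarrow> 0) (at_right 0))
       \<and> (\<forall>m::nat. m \<ge> 1 \<longrightarrow>
            integrable M (\<lambda>\<omega>. real (D \<omega>) ^ m) \<longrightarrow>
            \<P>(\<omega> in M. D \<omega> \<ge> m) > 0 \<longrightarrow>
            ((\<lambda>p. \<P>(\<omega> in M. thinning D (X p) \<omega> = m \<bar> thinning D (X p) \<omega> \<ge> m))
               \<longlongrightarrow> 1) (at_right 0))"
proof -
  interpret prob_space M by fact
  note [measurable] = assms(2)
  obtain q where q: "distr M (count_space UNIV) D = measure_pmf q"
    using ex_pmf_eq_distr[OF assms(2)] by blast
  have D_prob: "\<P>(\<omega> in M. D \<omega> \<ge> j) = measure_pmf.prob q {j..}" for j
    unfolding q[symmetric] by (subst measure_distr) (auto simp: vimage_def Int_def conj_commute)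
  have D_int: "integrable (measure_pmf q) (\<lambda>d. real d ^ j)"
    if "integrable M (\<lambda>\<omega>. real (D \<omega>) ^ j)" for j
    unfolding q[symmetric] using that by (subst integrable_distr_eq) auto
  have S_prob: "\<P>(\<omega> in M. thinning D (X p) \<omega> \<in> A) = measure_pmf.prob (thin_pmf q p) A"
    if p: "0 < p" "p < 1" for p A
  proof -
    have law: "distr M (count_space UNIV) (thinning D (X p)) = measure_pmf (thin_pmf q p)"
      by (rule distr_thinning[OF p assms(3)[OF p] q])
    have [measurable]: "X p i \<in> measurable M (count_space UNIV)" if "i \<ge> 1" for i
    proof -
      have "(X p)(0 := D) \<in> UNIV \<rightarrow> measurable M (count_space UNIV)"
        using assms(3)[OF p] by (auto simp: iid_bernoulli_indep_def indep_vars_def)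
      then have "((X p)(0 := D)) i \<in> measurable M (count_space UNIV)" by blast
      with that show ?thesis by simp
    qed
    have "(\<lambda>\<omega>. (\<lambda>d \<omega>. \<Sum>i = 1..d. X p i \<omega>) (D \<omega>) \<omega>) \<in> measurable M (count_space UNIV)"
      by (rule measurable_compose_countable) measurable
    then have [measurable]: "thinning D (X p) \<in> measurable M (count_space UNIV)"
      by (simp add: thinning_def[abs_def])
    show ?thesis
      unfolding law[symmetric] by (subst measure_distr) (auto simp: vimage_def Int_def conj_commute)
  qed
  have S_eq: "\<P>(\<omega> in M. thinning D (X p) \<omega> = j) = measure_pmf.prob (thin_pmf q p) {j}"
    and S_ge: "\<P>(\<omega> in M. thinning D (X p) \<omega> \<ge> j) = measure_pmf.prob (thin_pmf q p) {j..}"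
    if "0 < p" "p < 1" for p j
    using S_prob[OF that, of "{j}"] S_prob[OF that, of "{j..}"] by simp_all
  have ratio: "((\<lambda>p. \<P>(\<omega> in M. thinning D (X p) \<omega> \<ge> Suc j) / \<P>(\<omega> in M. thinning D (X p) \<omega> = j))
      \<longlongrightarrow> 0) (at_right 0)"
    if "integrable M (\<lambda>\<omega>. real (D \<omega>) ^ j)" "measure_pmf.prob q {j..} > 0" for j
  proof -
    from eventually_in_unit_interval have "\<forall>\<^sub>F p in at_right 0.
        measure_pmf.prob (thin_pmf q p) {Suc j..} / measure_pmf.prob (thin_pmf q p) {j}
        = \<P>(\<omega> in M. thinning D (X p) \<omega> \<ge> Suc j) / \<P>(\<omega> in M. thinning D (X p) \<omega> = j)"
      by eventually_elim (simp add: S_eq S_ge)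
    with thin_pmf_ratio_tendsto[OF D_int[OF that(1)] that(2)] show ?thesis
      by (rule Lim_transform_eventually)
  qed
  show ?thesis
  proof (intro conjI allI impI)
    fix k :: nat
    assume k: "k \<ge> 1" and int: "integrable M (\<lambda>\<omega>. real (D \<omega>) ^ (k - 1))"
      and pos: "\<forall>\<^sub>F p in at_right 0. \<P>(\<omega> in M. thinning D (X p) \<omega> = k - 1) > 0"
    \<comment> \<open>One such \<open>p\<close> suffices, as positivity depends on the law of \<open>D\<close> alone.\<close>
    from eventually_conj[OF eventually_in_unit_interval pos] obtain p
      where p: "0 < p" "p < 1" "\<P>(\<omega> in M. thinning D (X p) \<omega> = k - 1) > 0"
      using eventually_happens[of _ "at_right (0::real)"] by (auto simp: trivial_limit_at_right_real)
    then have "measure_pmf.prob q {k - 1..} > 0"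
      using thin_pmf_pos_iff S_eq by simp
    from ratio[OF int this] k
    show "((\<lambda>p. \<P>(\<omega> in M. thinning D (X p) \<omega> \<ge> k) / \<P>(\<omega> in M. thinning D (X p) \<omega> = k - 1))
               \<longlongrightarrow> 0) (at_right 0)" by simp
  next
    fix m :: nat
    \<comment> \<open>This is the first limit with \<open>k = m + 1\<close>, whose moment condition is the one on \<open>D ^ m\<close>.\<close>
    assume int: "integrable M (\<lambda>\<omega>. real (D \<omega>) ^ m)" and "\<P>(\<omega> in M. D \<omega> \<ge> m) > 0"
    then have pos: "measure_pmf.prob q {m..} > 0" by (simp add: D_prob)
    let ?r = "\<lambda>p. \<P>(\<omega> in M. thinning D (X p) \<omega> \<ge> Suc m) / \<P>(\<omega> in M. thinning D (X p) \<omega> = m)"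
    have "((\<lambda>p. 1 / (1 + ?r p)) \<longlongrightarrow> 1 / (1 + 0)) (at_right 0)"
      by (intro tendsto_intros ratio[OF int pos]) simp
    moreover have "\<forall>\<^sub>F p in at_right 0.
        1 / (1 + ?r p) = \<P>(\<omega> in M. thinning D (X p) \<omega> = m \<bar> thinning D (X p) \<omega> \<ge> m)"
      using eventually_in_unit_interval
    proof eventually_elim
      case (elim p)
      have "{m..} = {m} \<union> {Suc m..}" by auto
      then have split: "measure_pmf.prob (thin_pmf q p) {m..}
          = measure_pmf.prob (thin_pmf q p) {m} + measure_pmf.prob (thin_pmf q p) {Suc m..}"
        by (simp only:) (rule measure_pmf.finite_measure_Union, auto)
      have "{\<omega> \<in> space M. thinning D (X p) \<omega> = m \<and> m \<le> thinning D (X p) \<omega>}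
          = {\<omega> \<in> space M. thinning D (X p) \<omega> = m}" by auto
      moreover have "measure_pmf.prob (thin_pmf q p) {m} > 0"
        using elim pos thin_pmf_pos_iff by simp
      ultimately show ?case
        using elim by (simp add: cond_prob_def S_eq S_ge split field_simps)
    qed
    ultimately show "((\<lambda>p. \<P>(\<omega> in M. thinning D (X p) \<omega> = m \<bar> thinning D (X p) \<omega> \<ge> m))
               \<longlongrightarrow> 1) (at_right 0)"
      by (simp add: tendsto_cong)
  qed
qed

end
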